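(* Let $n,k$ be positive integers, let $r$ be a non-negative integer with $r<n$, let $\rho=(\rho_1,\dots,\rho_k)$ be integers with $1\le \rho_\ell\le n\le k$ for all $\ell\in[k]$ and $\sum_{\ell\in[k]}\rho_\ell=n^2$, and let $d=(d_1,\dots,d_k)$ be non-negative integers with $D:=\sum_{\ell\in[k]}d_\ell\le n-r$. Let $L$ be an $r\times r$ symmetric $\rho$-latin rectangle, let $e_\ell$ be the number of occurrences of $\ell$ in $L$ for $\ell\in[k]$, and let $q$ be the number of symbols $\ell\in[k]$ such that $\rho_\ell+e_\ell+d_\ell$ is odd. Suppose that $$(k-r)\left\lfloor\frac{\rho_\ell-e_\ell-d_\ell}{2}\right\rfloor\ge(n-r)(r-e_\ell)\ge(k-r)(\rho_\ell-e_\ell-n+r)\qquad\text{for all }\ell\in[k],$$ $$(r-e_{\ell'})\left\lfloor\frac{\rho_{\ell}-e_{\ell}-d_{\ell}}{2}\right\rfloor\ge(r-e_{\ell})(\rho_{\ell'}-e_{\ell'}-n+r)\qquad\text{for all }\ell,\ell'\in[k].$$ Then $L$ can be completed to an $n\times n$ symmetric $\rho$-latin square with prescribed diagonal tail $d$ if and only if $(n-r-D-q)/2$ is a non-negative integer.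
   Context: $[m]=\{1,\dots,m\}$. An $r\times r$ $\rho$-latin rectangle is an $r\times r$ array, every cell of which is filled with a symbol from $[k]$, such that each symbol occurs at most once in each row and at most once in each column, and each symbol $\ell\in[k]$ occurs at most $\rho_\ell$ times in the array. An $n\times n$ $\rho$-latin square is an $n\times n$ array, every cell filled with a symbol from $[k]$, such that each symbol occurs at most once in each row and at most once in each column, and each symbol $\ell\in[k]$ occurs exactly $\rho_\ell$ times. An array $A$ is symmetric if $A_{ij}=A_{ji}$ for all $i,j$. $L$ can be completed (extended, embedded) to an $n\times n$ array $L'$ means that $L$ is the top left $r\times r$ subarray of $L'$. $L'$ has prescribed diagonal tail $d$ means that each symbol $\ell\in[k]$ occurs at least $d_\ell$ times among the entries $L'_{ii}$, $r+1\le i\le n$. *)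

theory Defs
  imports Complex_Main
begin

text \<open>
  An \<open>m \<times> m\<close> array is a function of a row and a column index, both ranging over
  \<open>{1..m}\<close>; its values outside this range are irrelevant and never inspected.
  The symbols are \<open>{1..k}\<close>.
\<close>

type_synonym arr = "nat \<Rightarrow> nat \<Rightarrow> nat"

definition occurrences :: "nat \<Rightarrow> arr \<Rightarrow> nat \<Rightarrow> nat" where
  "occurrences m A l = card {(i, j). i \<in> {1..m} \<and> j \<in> {1..m} \<and> A i j = l}"

definition latin_array :: "nat \<Rightarrow> nat \<Rightarrow> arr \<Rightarrow> bool" where
  "latin_array m k A \<longleftrightarrow>
     (\<forall>i\<in>{1..m}. \<forall>j\<in>{1..m}. A i j \<in> {1..k}) \<and>
     (\<forall>i\<in>{1..m}. \<forall>l\<in>{1..k}. card {j \<in> {1..m}. A i j = l} \<le> 1) \<and>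
     (\<forall>j\<in>{1..m}. \<forall>l\<in>{1..k}. card {i \<in> {1..m}. A i j = l} \<le> 1)"

definition rho_latin_rectangle :: "nat \<Rightarrow> nat \<Rightarrow> (nat \<Rightarrow> nat) \<Rightarrow> arr \<Rightarrow> bool" where
  "rho_latin_rectangle r k \<rho> A \<longleftrightarrow>
     latin_array r k A \<and> (\<forall>l\<in>{1..k}. occurrences r A l \<le> \<rho> l)"

definition rho_latin_square :: "nat \<Rightarrow> nat \<Rightarrow> (nat \<Rightarrow> nat) \<Rightarrow> arr \<Rightarrow> bool" where
  "rho_latin_square n k \<rho> A \<longleftrightarrow>
     latin_array n k A \<and> (\<forall>l\<in>{1..k}. occurrences n A l = \<rho> l)"

definition symmetric_array :: "nat \<Rightarrow> arr \<Rightarrow> bool" where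
  "symmetric_array m A \<longleftrightarrow> (\<forall>i\<in>{1..m}. \<forall>j\<in>{1..m}. A i j = A j i)"

definition top_left_subarray :: "nat \<Rightarrow> arr \<Rightarrow> arr \<Rightarrow> bool" where
  "top_left_subarray r L A \<longleftrightarrow> (\<forall>i\<in>{1..r}. \<forall>j\<in>{1..r}. A i j = L i j)"

definition prescribed_diagonal_tail ::
    "nat \<Rightarrow> nat \<Rightarrow> nat \<Rightarrow> (nat \<Rightarrow> nat) \<Rightarrow> arr \<Rightarrow> bool" where
  "prescribed_diagonal_tail r n k d A \<longleftrightarrow>
     (\<forall>l\<in>{1..k}. d l \<le> card {i \<in> {r + 1..n}. A i i = l})"

end

(*
A symmetric array is an edge colouring of a complete graph with loops, and a completion of L is
built by rounding fractional solutions of transportation problems to integral ones.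
First, giving every missing (row, symbol) pair the weight (n - r) / (k - r) fixes which symbols each
row of L receives; the first pair of hypothesised inequalities says exactly that this weighting is feasible,
i.e. that all copies of a symbol outside L fit, with room for d and for the parity of the diagonal.
The symbols of the remaining m x m corner are then split into diagonal and off-diagonal ones.
As long as every symbol has at most m places left, the rows can be added one at a time: taking
1/m of everything that is left is a fractional choice of the next row, and after rounding every
symbol has at most m - 1 places left.
Conversely, in a symmetric array the number of occurrences of a symbol has the parity of its
number of diagonal occurrences, so the tail needs at least D + q diagonal cells, and the
excess is even.
*)

theory Submission
  imports Defs
begin

section \<open>Rounding a matrix with its line sums\<close>

text \<open>Induction on the number of equations. Dropping an unknown leaves enough unknowns for the
  smaller system, which gives two solutions \<open>z1\<close> and \<open>z2\<close> that differ at a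
  coordinate \<open>e1\<close>; a combination of them also satisfies the new equation.\<close>

lemma homogeneous_system_nontrivial_solution:
  fixes a :: "'i \<Rightarrow> 'e \<Rightarrow> real"
  assumes "finite I" "finite E" "card I < card E"
  shows "\<exists>z. (\<forall>e. e \<notin> E \<longrightarrow> z e = 0) \<and> (\<exists>e\<in>E. z e \<noteq> 0) \<and> (\<forall>i\<in>I. (\<Sum>e\<in>E. a i e * z e) = 0)"
  using assms
proof (induction I arbitrary: E rule: finite_induct)
  case empty
  then obtain e0 where "e0 \<in> E" by fastforce
  then show ?case by (intro exI[of _ "\<lambda>e. if e = e0 then 1 else 0"]) auto
next
  case (insert i I)
  have sub: "\<exists>z. (\<forall>e. e \<notin> E \<longrightarrow> z e = 0) \<and> z e0 = 0 \<and> (\<exists>e\<in>E. z e \<noteq> 0) \<and>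
      (\<forall>i\<in>I. (\<Sum>e\<in>E. a i e * z e) = 0)" if "e0 \<in> E" for e0
  proof -
    have "card I < card (E - {e0})"
      using insert.prems insert.hyps that by (simp add: card_Diff_singleton)
    then obtain z where z: "\<forall>e. e \<notin> E - {e0} \<longrightarrow> z e = 0" "\<exists>e\<in>E - {e0}. z e \<noteq> 0"
      "\<forall>i\<in>I. (\<Sum>e\<in>E - {e0}. a i e * z e) = 0"
      using insert.IH[of "E - {e0}"] insert.prems by blast
    have "(\<Sum>e\<in>E. a i e * z e) = (\<Sum>e\<in>E - {e0}. a i e * z e)" for i
      using z(1) insert.prems by (intro sum.mono_neutral_right) auto
    with z show ?thesis by (intro exI[of _ z]) auto
  qed
  obtain e0 where "e0 \<in> E" using insert.prems by fastforce
  from sub[OF this] obtain z1 e1 where z1: "\<forall>e. e \<notin> E \<longrightarrow> z1 e = 0"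
    "e1 \<in> E" "z1 e1 \<noteq> 0" "\<forall>i\<in>I. (\<Sum>e\<in>E. a i e * z1 e) = 0" by blast
  from sub[OF z1(2)] obtain z2 e2 where z2: "\<forall>e. e \<notin> E \<longrightarrow> z2 e = 0" "z2 e1 = 0"
    "e2 \<in> E" "z2 e2 \<noteq> 0" "\<forall>i\<in>I. (\<Sum>e\<in>E. a i e * z2 e) = 0" by blast
  define c1 where "c1 = (\<Sum>e\<in>E. a i e * z1 e)"
  define c2 where "c2 = (\<Sum>e\<in>E. a i e * z2 e)"
  show ?case
  proof (cases "c2 = 0")
    case True
    then show ?thesis using z2 by (intro exI[of _ z2]) (auto simp: c2_def)
  next
    case False
    \<comment> \<open>The coefficients cancel the left-hand side of equation \<open>i\<close>. Since
      \<open>z2\<close> vanishes at \<open>e1\<close> and \<open>c2\<close> does not vanish, the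
      value at \<open>e1\<close> is nonzero.\<close>
    define z where "z e = c1 * z2 e - c2 * z1 e" for e
    have lin: "(\<Sum>e\<in>E. a j e * z e) =
        c1 * (\<Sum>e\<in>E. a j e * z2 e) - c2 * (\<Sum>e\<in>E. a j e * z1 e)" for j
      by (simp add: z_def sum_distrib_left sum_subtractf algebra_simps)
    have "z e1 \<noteq> 0" using False z1 z2 by (simp add: z_def)
    moreover have "\<forall>j\<in>insert i I. (\<Sum>e\<in>E. a j e * z e) = 0"
      unfolding lin using z1 z2 by (auto simp: c1_def c2_def)
    moreover have "\<forall>e. e \<notin> E \<longrightarrow> z e = 0" using z1 z2 by (simp add: z_def)
    ultimately show ?thesis using z1(2) by blast
  qed
qed

text \<open>Every nonempty fibre of \<open>h\<close> has at least two elements. For \<open>h\<close>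
  equal to \<open>fst\<close> or \<open>snd\<close> this compares the number of fractional cells
  with the number of rows or columns that they meet.\<close>

lemma card_ge_twice_card_image:
  assumes "finite N" "\<And>u. u \<in> N \<Longrightarrow> \<exists>v\<in>N. v \<noteq> u \<and> h v = h u"
  shows "2 * card (h ` N) \<le> card N"
proof -
  have "2 \<le> card {v \<in> N. h v = y}" if "y \<in> h ` N" for y
  proof -
    from that obtain u where u: "u \<in> N" "h u = y" by auto
    with assms(2)[OF u(1)] obtain v where v: "v \<in> N" "v \<noteq> u" "h v = y" by auto
    have "card {u, v} \<le> card {v \<in> N. h v = y}"
      using u v assms(1) by (intro card_mono) auto
    then show ?thesis using v(2) by simp
  qed
  then have "(\<Sum>y\<in>h ` N. 2) \<le> (\<Sum>y\<in>h ` N. card {v \<in> N. h v = y})" by (intro sum_mono)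
  also have "\<dots> = (\<Sum>v\<in>N. 1)"
    using sum.image_gen[OF assms(1), of "\<lambda>_. 1::nat" h] by simp
  finally show ?thesis by simp
qed

lemma sum_Ints_other_non_Int:
  fixes h :: "'a \<Rightarrow> real"
  assumes "finite S" "sum h S \<in> \<int>" "s \<in> S" "h s \<notin> \<int>"
  shows "\<exists>t\<in>S. t \<noteq> s \<and> h t \<notin> \<int>"
proof (rule ccontr)
  assume "\<not> ?thesis"
  then have "sum h (S - {s}) \<in> \<int>" by (intro Ints_sum) auto
  moreover have "h s = sum h S - sum h (S - {s})" using assms by (simp add: sum_diff1)
  ultimately show False using assms by (metis Ints_diff)
qed

text \<open>The fractional entries form a bipartite graph of minimum degree at least two, so they are
  at least as many as the rows and columns meeting them, and the row and column sum
  equations on them are linearly dependent.\<close>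
lemma fractional_support_kernel:
  fixes x :: "'a \<Rightarrow> 'c \<Rightarrow> real"
  assumes fin: "finite A" "finite C"
    and rows: "\<And>i. i \<in> A \<Longrightarrow> (\<Sum>j\<in>C. x i j) \<in> \<int>"
    and cols: "\<And>j. j \<in> C \<Longrightarrow> (\<Sum>i\<in>A. x i j) \<in> \<int>"
    and frac: "i0 \<in> A" "j0 \<in> C" "x i0 j0 \<notin> \<int>"
  obtains z :: "'a \<Rightarrow> 'c \<Rightarrow> real" and i1 j1 where "i1 \<in> A" "j1 \<in> C" "z i1 j1 \<noteq> 0"
    "\<forall>i\<in>A. \<forall>j\<in>C. x i j \<in> \<int> \<longrightarrow> z i j = 0"
    "\<forall>i\<in>A. (\<Sum>j\<in>C. z i j) = 0" "\<forall>j\<in>C. (\<Sum>i\<in>A. z i j) = 0"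
proof -
  define N where "N = {(i, j). i \<in> A \<and> j \<in> C \<and> x i j \<notin> \<int>}"
  have NAC: "N \<subseteq> A \<times> C" and finN: "finite N"
    using fin by (auto simp: N_def intro: finite_subset[of _ "A \<times> C"])
  have "2 * card (fst ` N) \<le> card N"
  proof (rule card_ge_twice_card_image[OF finN])
    fix u assume "u \<in> N"
    then obtain i j where u: "u = (i, j)" "i \<in> A" "j \<in> C" "x i j \<notin> \<int>" by (auto simp: N_def)
    obtain j' where "j' \<in> C" "j' \<noteq> j" "x i j' \<notin> \<int>"
      using sum_Ints_other_non_Int[OF fin(2) rows[OF u(2)] u(3) u(4)] by blast
    then show "\<exists>v\<in>N. v \<noteq> u \<and> fst v = fst u"
      using u by (intro bexI[of _ "(i, j')"]) (auto simp: N_def)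
  qed
  moreover have "2 * card (snd ` N) \<le> card N"
  proof (rule card_ge_twice_card_image[OF finN])
    fix u assume "u \<in> N"
    then obtain i j where u: "u = (i, j)" "i \<in> A" "j \<in> C" "x i j \<notin> \<int>" by (auto simp: N_def)
    obtain i' where "i' \<in> A" "i' \<noteq> i" "x i' j \<notin> \<int>"
      using sum_Ints_other_non_Int[OF fin(1) cols[OF u(3)] u(2) u(4)] by blast
    then show "\<exists>v\<in>N. v \<noteq> u \<and> snd v = snd u"
      using u by (intro bexI[of _ "(i', j)"]) (auto simp: N_def)
  qed
  moreover have j0: "j0 \<in> snd ` N" using frac by (force simp: N_def)
  \<comment> \<open>The two bounds only give at most as many lines as fractional cells. Omitting the
    equation of column \<open>j0\<close> makes the inequality strict.\<close>
  moreover have "card (snd ` N - {j0}) < card (snd ` N)"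
    using finN j0 by (intro psubset_card_mono) auto
  ultimately have card: "card (fst ` N <+> (snd ` N - {j0})) < card N"
    using finN by (simp add: card_Plus)
  define a :: "'a + 'c \<Rightarrow> 'a \<times> 'c \<Rightarrow> real" where "a = (\<lambda>t u. case t of Inl i \<Rightarrow> of_bool (fst u = i)
    | Inr j \<Rightarrow> of_bool (snd u = j))"
  obtain z where z: "\<forall>e. e \<notin> N \<longrightarrow> z e = 0" "\<exists>e\<in>N. z e \<noteq> 0"
    "\<forall>t\<in>fst ` N <+> (snd ` N - {j0}). (\<Sum>e\<in>N. a t e * z e) = 0"
    using homogeneous_system_nontrivial_solution[OF _ finN card, of a] finN by auto
  have tot: "(\<Sum>e\<in>N. h e * z e) = (\<Sum>i\<in>A. \<Sum>j\<in>C. h (i, j) * z (i, j))" for h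
  proof -
    have "(\<Sum>e\<in>N. h e * z e) = (\<Sum>e\<in>A \<times> C. h e * z e)"
      using z(1) fin NAC by (intro sum.mono_neutral_left) auto
    then show ?thesis by (simp add: sum.cartesian_product)
  qed
  have row: "(\<Sum>j\<in>C. z (i, j)) = 0" if "i \<in> A" for i
  proof (cases "i \<in> fst ` N")
    case True
    then have "0 = (\<Sum>e\<in>N. a (Inl i) e * z e)" using z(3) by (metis InlI)
    also have "\<dots> = (\<Sum>i'\<in>A. \<Sum>j\<in>C. a (Inl i) (i', j) * z (i', j))" by (rule tot)
    also have "\<dots> = (\<Sum>i'\<in>A. if i' = i then \<Sum>j\<in>C. z (i', j) else 0)"
      by (intro sum.cong) (auto simp: a_def)
    also have "\<dots> = (\<Sum>j\<in>C. z (i, j))" using that fin by simp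
    finally show ?thesis by simp
  next
    case False
    then have "z (i, j) = 0" for j using z(1) by (metis fst_conv image_eqI)
    then show ?thesis by simp
  qed
  have col': "(\<Sum>i\<in>A. z (i, j)) = 0" if "j \<in> C" "j \<noteq> j0" for j
  proof (cases "j \<in> snd ` N")
    case True
    then have "0 = (\<Sum>e\<in>N. a (Inr j) e * z e)"
      using z(3) that by (metis InrI DiffI empty_iff insert_iff)
    also have "\<dots> = (\<Sum>i\<in>A. \<Sum>j'\<in>C. a (Inr j) (i, j') * z (i, j'))" by (rule tot)
    also have "\<dots> = (\<Sum>i\<in>A. \<Sum>j'\<in>C. if j' = j then z (i, j') else 0)"
      by (intro sum.cong) (auto simp: a_def)
    also have "\<dots> = (\<Sum>i\<in>A. z (i, j))" using that fin by simp
    finally show ?thesis by simp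
  next
    case False
    then have "z (i, j) = 0" for i using z(1) by (metis snd_conv image_eqI)
    then show ?thesis by simp
  qed
  \<comment> \<open>The omitted equation of column \<open>j0\<close> follows: all rows sum to zero,
    hence so does the whole matrix, and all other columns sum to zero.\<close>
  have "(\<Sum>j\<in>C. \<Sum>i\<in>A. z (i, j)) = 0"
    using row by (subst sum.swap) simp
  then have "(\<Sum>i\<in>A. z (i, j0)) = 0"
    using fin frac col' by (simp add: sum.remove[of C j0])
  with col' have col: "(\<Sum>i\<in>A. z (i, j)) = 0" if "j \<in> C" for j using that by metis
  from z(2) obtain i1 j1 where "(i1, j1) \<in> N" "z (i1, j1) \<noteq> 0" by auto
  with NAC row col z(1) show thesis
    by (intro that[of i1 j1 "\<lambda>i j. z (i, j)"]) (auto simp: N_def)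
qed

section \<open>Rounding by descent on the number of fractional entries\<close>

text \<open>Moving along a kernel vector that lives on the fractional entries preserves all line
  sums and all integral entries. Stopping when the first entry reaches its floor or ceiling leaves
  fewer fractional entries, without leaving the allowed intervals.\<close>

lemma round_matrix_integral_sums:
  fixes x :: "'a \<Rightarrow> 'c \<Rightarrow> real"
  assumes fin: "finite A" "finite C"
    and "\<And>i. i \<in> A \<Longrightarrow> (\<Sum>j\<in>C. x i j) \<in> \<int>"
    and "\<And>j. j \<in> C \<Longrightarrow> (\<Sum>i\<in>A. x i j) \<in> \<int>"
  shows "\<exists>y :: 'a \<Rightarrow> 'c \<Rightarrow> int.
    (\<forall>i\<in>A. \<forall>j\<in>C. \<lfloor>x i j\<rfloor> \<le> y i j \<and> y i j \<le> \<lceil>x i j\<rceil>) \<and>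
    (\<forall>i\<in>A. (\<Sum>j\<in>C. of_int (y i j)) = (\<Sum>j\<in>C. x i j)) \<and>
    (\<forall>j\<in>C. (\<Sum>i\<in>A. of_int (y i j)) = (\<Sum>i\<in>A. x i j))"
  using assms(3,4)
proof (induction "card {(i, j). i \<in> A \<and> j \<in> C \<and> x i j \<notin> \<int>}" arbitrary: x rule: less_induct)
  case less
  define N where "N x = {(i, j). i \<in> A \<and> j \<in> C \<and> x i j \<notin> \<int>}" for x :: "'a \<Rightarrow> 'c \<Rightarrow> real"
  have finN: "finite (N x)" for x
    using fin by (auto simp: N_def intro: finite_subset[of _ "A \<times> C"])
  show ?case
  proof (cases "N x = {}")
    case True
    then have "of_int \<lfloor>x i j\<rfloor> = x i j" if "i \<in> A" "j \<in> C" for i j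
      using that by (auto simp: N_def)
    then show ?thesis by (intro exI[of _ "\<lambda>i j. \<lfloor>x i j\<rfloor>"]) (auto intro!: sum.cong simp: floor_le_ceiling)
  next
    case False
    then obtain i0 j0 where frac: "i0 \<in> A" "j0 \<in> C" "x i0 j0 \<notin> \<int>" by (auto simp: N_def)
    obtain z :: "'a \<Rightarrow> 'c \<Rightarrow> real" and i1 j1 where z: "i1 \<in> A" "j1 \<in> C" "z i1 j1 \<noteq> 0"
      "\<forall>i\<in>A. \<forall>j\<in>C. x i j \<in> \<int> \<longrightarrow> z i j = 0"
      "\<forall>i\<in>A. (\<Sum>j\<in>C. z i j) = 0" "\<forall>j\<in>C. (\<Sum>i\<in>A. z i j) = 0"
      by (rule fractional_support_kernel[OF fin less.prems frac])
    define M where "M = {(i, j). i \<in> A \<and> j \<in> C \<and> z i j \<noteq> 0}"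
    \<comment> \<open>The step length at which a moving entry reaches the integer it is heading for;
      the minimum \<open>t\<close> is the first such event.\<close>
    define s where "s = (\<lambda>(i, j). if z i j > 0 then (\<lceil>x i j\<rceil> - x i j) / z i j
      else (\<lfloor>x i j\<rfloor> - x i j) / z i j)"
    define t where "t = Min (s ` M)"
    have M: "M \<subseteq> N x" "(i1, j1) \<in> M" using z by (auto simp: M_def N_def)
    have finM: "finite M" by (rule finite_subset[OF M(1) finN])
    have "s u \<ge> 0" for u
      by (auto simp: s_def split: prod.split intro!: divide_nonneg_pos divide_nonpos_nonpos)
    then have t0: "t \<ge> 0" using M finM unfolding t_def by (subst Min_ge_iff) auto
    have ts: "t \<le> s u" if "u \<in> M" for u using finM that by (auto simp: t_def)
    define x' where "x' i j = x i j + t * z i j" for i j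
    have bounds: "\<lfloor>x i j\<rfloor> \<le> x' i j \<and> x' i j \<le> \<lceil>x i j\<rceil>" if ij: "i \<in> A" "j \<in> C" for i j
    proof -
      consider "z i j = 0" | "z i j > 0" | "z i j < 0" by linarith
      then show ?thesis
      proof cases
        case 1
        then show ?thesis by (simp add: x'_def)
      next
        case 2
        then have "t \<le> (\<lceil>x i j\<rceil> - x i j) / z i j"
          using ts[of "(i, j)"] ij by (auto simp: M_def s_def)
        then have "t * z i j \<le> \<lceil>x i j\<rceil> - x i j" using 2 by (simp add: pos_le_divide_eq)
        moreover have "t * z i j \<ge> 0" using t0 2 by simp
        ultimately show ?thesis using of_int_floor_le[of "x i j"] unfolding x'_def by linarith
      next
        case 3
        then have "t \<le> (\<lfloor>x i j\<rfloor> - x i j) / z i j"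
          using ts[of "(i, j)"] ij by (auto simp: M_def s_def)
        then have "t * z i j \<ge> \<lfloor>x i j\<rfloor> - x i j" using 3 by (simp add: neg_le_divide_eq)
        moreover have "t * z i j \<le> 0" using t0 3 by (simp add: mult_nonneg_nonpos)
        ultimately show ?thesis using le_of_int_ceiling[of "x i j"] unfolding x'_def by linarith
      qed
    qed
    have "t \<in> s ` M" unfolding t_def using M finM by (intro Min_in) auto
    then obtain i2 j2 where m2: "(i2, j2) \<in> M" "t = s (i2, j2)" by auto
    then have "x' i2 j2 \<in> {of_int \<lceil>x i2 j2\<rceil>, of_int \<lfloor>x i2 j2\<rfloor>}"
      by (auto simp: x'_def s_def M_def)
    then have "(i2, j2) \<notin> N x'" by (auto simp: N_def)
    moreover have "N x' \<subseteq> N x" using z(4) by (auto simp: N_def x'_def)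
    ultimately have "N x' \<subset> N x" using m2 M by blast
    then have "card (N x') < card (N x)" by (intro psubset_card_mono finN)
    moreover have rows: "(\<Sum>j\<in>C. x' i j) = (\<Sum>j\<in>C. x i j)" if "i \<in> A" for i
      using z(5) that by (simp add: x'_def sum.distrib flip: sum_distrib_left)
    moreover have cols: "(\<Sum>i\<in>A. x' i j) = (\<Sum>i\<in>A. x i j)" if "j \<in> C" for j
      using z(6) that by (simp add: x'_def sum.distrib flip: sum_distrib_left)
    ultimately obtain y :: "'a \<Rightarrow> 'c \<Rightarrow> int" where
      y: "\<forall>i\<in>A. \<forall>j\<in>C. \<lfloor>x' i j\<rfloor> \<le> y i j \<and> y i j \<le> \<lceil>x' i j\<rceil>"
      "\<forall>i\<in>A. (\<Sum>j\<in>C. of_int (y i j)) = (\<Sum>j\<in>C. x' i j)"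
      "\<forall>j\<in>C. (\<Sum>i\<in>A. of_int (y i j)) = (\<Sum>i\<in>A. x' i j)"
      using less.hyps[of x'] less.prems unfolding N_def by (auto cong: sum.cong)
    \<comment> \<open>The intervals for \<open>x'\<close> lie inside those for \<open>x\<close>, so
      the rounding of \<open>x'\<close> also rounds \<open>x\<close>.\<close>
    have "\<lfloor>x i j\<rfloor> \<le> y i j \<and> y i j \<le> \<lceil>x i j\<rceil>" if "i \<in> A" "j \<in> C" for i j
    proof -
      have "\<lfloor>x i j\<rfloor> \<le> \<lfloor>x' i j\<rfloor>" "\<lceil>x' i j\<rceil> \<le> \<lceil>x i j\<rceil>"
        using bounds[OF that] by (auto simp: le_floor_iff ceiling_le_iff)
      then show ?thesis using y(1) that by force
    qed
    with y rows cols show ?thesis by (intro exI[of _ y]) auto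
  qed
qed

text \<open>A slack row and a slack column make all line sums vanish; rounding the slack entries
  then rounds the original line sums.\<close>
lemma round_matrix:
  fixes x :: "'a \<Rightarrow> 'c \<Rightarrow> real"
  assumes fin: "finite A" "finite C"
  shows "\<exists>y :: 'a \<Rightarrow> 'c \<Rightarrow> int.
    (\<forall>i\<in>A. \<forall>j\<in>C. \<lfloor>x i j\<rfloor> \<le> y i j \<and> y i j \<le> \<lceil>x i j\<rceil>) \<and>
    (\<forall>i\<in>A. \<lfloor>\<Sum>j\<in>C. x i j\<rfloor> \<le> (\<Sum>j\<in>C. y i j) \<and> (\<Sum>j\<in>C. y i j) \<le> \<lceil>\<Sum>j\<in>C. x i j\<rceil>) \<and>
    (\<forall>j\<in>C. \<lfloor>\<Sum>i\<in>A. x i j\<rfloor> \<le> (\<Sum>i\<in>A. y i j) \<and> (\<Sum>i\<in>A. y i j) \<le> \<lceil>\<Sum>i\<in>A. x i j\<rceil>)"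
proof -
  define A' where "A' = insert None (Some ` A)"
  define C' where "C' = insert None (Some ` C)"
  define X where "X i j = (case (i, j) of (Some i, Some j) \<Rightarrow> x i j
    | (Some i, None) \<Rightarrow> - (\<Sum>j\<in>C. x i j)
    | (None, Some j) \<Rightarrow> - (\<Sum>i\<in>A. x i j)
    | (None, None) \<Rightarrow> (\<Sum>i\<in>A. \<Sum>j\<in>C. x i j))" for i j
  have sumA: "(\<Sum>i\<in>A'. h i) = h None + (\<Sum>i\<in>A. h (Some i))" for h :: "'a option \<Rightarrow> real"
    using fin unfolding A'_def by (subst sum.insert) (auto simp: sum.reindex)
  have sumC: "(\<Sum>j\<in>C'. h j) = h None + (\<Sum>j\<in>C. h (Some j))" for h :: "'c option \<Rightarrow> real"
    using fin unfolding C'_def by (subst sum.insert) (auto simp: sum.reindex)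
  have rows: "(\<Sum>j\<in>C'. X i j) = 0" for i
    by (cases i) (auto simp: sumC X_def sum_negf sum.swap[of _ C A])
  have cols: "(\<Sum>i\<in>A'. X i j) = 0" for j
    by (cases j) (auto simp: sumA X_def sum_negf)
  obtain y :: "'a option \<Rightarrow> 'c option \<Rightarrow> int" where
    y: "\<forall>i\<in>A'. \<forall>j\<in>C'. \<lfloor>X i j\<rfloor> \<le> y i j \<and> y i j \<le> \<lceil>X i j\<rceil>"
    "\<forall>i\<in>A'. (\<Sum>j\<in>C'. of_int (y i j)) = (0::real)"
    "\<forall>j\<in>C'. (\<Sum>i\<in>A'. of_int (y i j)) = (0::real)"
    using round_matrix_integral_sums[of A' C' X] fin rows cols by (auto simp: A'_def C'_def)
  show ?thesis
  proof (intro exI[of _ "\<lambda>i j. y (Some i) (Some j)"] conjI ballI)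
    fix i j assume "i \<in> A" "j \<in> C"
    then have "\<lfloor>X (Some i) (Some j)\<rfloor> \<le> y (Some i) (Some j) \<and>
      y (Some i) (Some j) \<le> \<lceil>X (Some i) (Some j)\<rceil>" using y(1) by (auto simp: A'_def C'_def)
    then show "\<lfloor>x i j\<rfloor> \<le> y (Some i) (Some j)" "y (Some i) (Some j) \<le> \<lceil>x i j\<rceil>"
      by (auto simp: X_def)
  next
    fix i assume i: "i \<in> A"
    have "real_of_int (y (Some i) None + (\<Sum>j\<in>C. y (Some i) (Some j))) = 0"
      using y(2) i sumC[of "\<lambda>j. of_int (y (Some i) j)"] by (auto simp: A'_def)
    \<comment> \<open>The slack entry is minus the line sum both before and after rounding; negation
      exchanges floor and ceiling.\<close>
    then have "(\<Sum>j\<in>C. y (Some i) (Some j)) = - y (Some i) None" by linarith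
    moreover have "\<lfloor>X (Some i) None\<rfloor> \<le> y (Some i) None \<and> y (Some i) None \<le> \<lceil>X (Some i) None\<rceil>"
      using y(1) i by (auto simp: A'_def C'_def)
    ultimately show "\<lfloor>\<Sum>j\<in>C. x i j\<rfloor> \<le> (\<Sum>j\<in>C. y (Some i) (Some j))"
      "(\<Sum>j\<in>C. y (Some i) (Some j)) \<le> \<lceil>\<Sum>j\<in>C. x i j\<rceil>"
      by (auto simp: X_def floor_minus ceiling_minus)
  next
    fix j assume j: "j \<in> C"
    have "real_of_int (y None (Some j) + (\<Sum>i\<in>A. y (Some i) (Some j))) = 0"
      using y(3) j sumA[of "\<lambda>i. of_int (y i (Some j))"] by (auto simp: C'_def)
    then have "(\<Sum>i\<in>A. y (Some i) (Some j)) = - y None (Some j)" by linarith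
    moreover have "\<lfloor>X None (Some j)\<rfloor> \<le> y None (Some j) \<and> y None (Some j) \<le> \<lceil>X None (Some j)\<rceil>"
      using y(1) j by (auto simp: A'_def C'_def)
    ultimately show "\<lfloor>\<Sum>i\<in>A. x i j\<rfloor> \<le> (\<Sum>i\<in>A. y (Some i) (Some j))"
      "(\<Sum>i\<in>A. y (Some i) (Some j)) \<le> \<lceil>\<Sum>i\<in>A. x i j\<rceil>"
      by (auto simp: X_def floor_minus ceiling_minus)
  qed
qed

text \<open>Rounding of \<open>w\<close> divided by \<open>m\<close>, with every bound stated
  through multiples of \<open>m\<close>, so that the combinatorial applications stay in the natural
  numbers.\<close>

lemma round_matrix_quotient:
  fixes w :: "'a \<Rightarrow> 'c \<Rightarrow> nat"
  assumes fin: "finite A" "finite C" and m: "m > 0"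
  shows "\<exists>y :: 'a \<Rightarrow> 'c \<Rightarrow> nat.
    (\<forall>i\<in>A. \<forall>j\<in>C. \<forall>s. w i j \<le> m * s \<longrightarrow> y i j \<le> s) \<and>
    (\<forall>i\<in>A. \<forall>s. (\<Sum>j\<in>C. w i j) = m * s \<longrightarrow> (\<Sum>j\<in>C. y i j) = s) \<and>
    (\<forall>j\<in>C. \<forall>s. (\<Sum>i\<in>A. w i j) \<le> m * s \<longrightarrow> (\<Sum>i\<in>A. y i j) \<le> s) \<and>
    (\<forall>j\<in>C. \<forall>s. m * s \<le> (\<Sum>i\<in>A. w i j) \<longrightarrow> s \<le> (\<Sum>i\<in>A. y i j))"
proof -
  have up: "\<lceil>real a / real m\<rceil> \<le> int s \<longleftrightarrow> a \<le> m * s" for a s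
  proof -
    have "\<lceil>real a / real m\<rceil> \<le> int s \<longleftrightarrow> real a \<le> real (m * s)"
      using m by (simp add: ceiling_le_iff pos_divide_le_eq mult.commute)
    then show ?thesis by (metis of_nat_le_iff)
  qed
  have lo: "int s \<le> \<lfloor>real a / real m\<rfloor> \<longleftrightarrow> m * s \<le> a" for a s
  proof -
    have "int s \<le> \<lfloor>real a / real m\<rfloor> \<longleftrightarrow> real (m * s) \<le> real a"
      using m by (simp add: le_floor_iff pos_le_divide_eq mult.commute)
    then show ?thesis by (metis of_nat_le_iff)
  qed
  obtain y :: "'a \<Rightarrow> 'c \<Rightarrow> int" where
    y: "\<forall>i\<in>A. \<forall>j\<in>C. \<lfloor>real (w i j) / real m\<rfloor> \<le> y i j \<and> y i j \<le> \<lceil>real (w i j) / real m\<rceil>"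
    "\<forall>i\<in>A. \<lfloor>\<Sum>j\<in>C. real (w i j) / real m\<rfloor> \<le> (\<Sum>j\<in>C. y i j) \<and>
       (\<Sum>j\<in>C. y i j) \<le> \<lceil>\<Sum>j\<in>C. real (w i j) / real m\<rceil>"
    "\<forall>j\<in>C. \<lfloor>\<Sum>i\<in>A. real (w i j) / real m\<rfloor> \<le> (\<Sum>i\<in>A. y i j) \<and>
       (\<Sum>i\<in>A. y i j) \<le> \<lceil>\<Sum>i\<in>A. real (w i j) / real m\<rceil>"
    using round_matrix[OF fin, of "\<lambda>i j. real (w i j) / real m"] by blast
  have pos: "int (nat (y i j)) = y i j" if "i \<in> A" "j \<in> C" for i j
  proof -
    have "0 \<le> \<lfloor>real (w i j) / real m\<rfloor>" by simp
    also have "\<dots> \<le> y i j" using y(1) that by blast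
    finally show ?thesis by simp
  qed
  have eqr: "int (\<Sum>j\<in>C. nat (y i j)) = (\<Sum>j\<in>C. y i j)" if "i \<in> A" for i
    using pos that by (simp del: int_nat_eq)
  have eqc: "int (\<Sum>i\<in>A. nat (y i j)) = (\<Sum>i\<in>A. y i j)" if "j \<in> C" for j
    using pos that by (simp del: int_nat_eq)
  have sumr: "(\<Sum>j\<in>C. real (w i j) / real m) = real (\<Sum>j\<in>C. w i j) / real m" for i
    by (simp add: sum_divide_distrib)
  have sumc: "(\<Sum>i\<in>A. real (w i j) / real m) = real (\<Sum>i\<in>A. w i j) / real m" for j
    by (simp add: sum_divide_distrib)
  show ?thesis
  proof (intro exI[of _ "\<lambda>i j. nat (y i j)"] conjI ballI allI impI)
    fix i j s assume ij: "i \<in> A" "j \<in> C" and "w i j \<le> m * s"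
    then have "\<lceil>real (w i j) / real m\<rceil> \<le> int s" using up by blast
    then have "y i j \<le> int s" using y(1) ij by force
    then show "nat (y i j) \<le> s" by simp
  next
    fix i s assume i: "i \<in> A" and "(\<Sum>j\<in>C. w i j) = m * s"
    then have "\<lceil>real (\<Sum>j\<in>C. w i j) / real m\<rceil> \<le> int s" "int s \<le> \<lfloor>real (\<Sum>j\<in>C. w i j) / real m\<rfloor>"
      unfolding up lo by auto
    then have "(\<Sum>j\<in>C. y i j) = int s" using y(2) i unfolding sumr by force
    then show "(\<Sum>j\<in>C. nat (y i j)) = s" using eqr[OF i] by linarith
  next
    fix j s assume j: "j \<in> C" and "(\<Sum>i\<in>A. w i j) \<le> m * s"
    then have "\<lceil>real (\<Sum>i\<in>A. w i j) / real m\<rceil> \<le> int s" using up by blast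
    then have "(\<Sum>i\<in>A. y i j) \<le> int s" using y(3) j unfolding sumc by force
    then show "(\<Sum>i\<in>A. nat (y i j)) \<le> s" using eqc[OF j] by linarith
  next
    fix j s assume j: "j \<in> C" and "m * s \<le> (\<Sum>i\<in>A. w i j)"
    then have "int s \<le> \<lfloor>real (\<Sum>i\<in>A. w i j) / real m\<rfloor>" using lo by blast
    then have "int s \<le> (\<Sum>i\<in>A. y i j)" using y(3) j unfolding sumc by force
    then show "s \<le> (\<Sum>i\<in>A. nat (y i j))" using eqc[OF j] by linarith
  qed
qed

section \<open>Adding rows to symmetric latin arrays\<close>

lemma occurrences_eq_sum:
  "occurrences m A l = (\<Sum>i\<in>{1..m}. \<Sum>j\<in>{1..m}. of_bool (A i j = l))"
proof -
  have "{(i, j). i \<in> {1..m} \<and> j \<in> {1..m} \<and> A i j = l} =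
      {1..m} \<times> {1..m} \<inter> {u. A (fst u) (snd u) = l}" by auto
  then have "occurrences m A l = (\<Sum>u\<in>{1..m} \<times> {1..m}. of_bool (A (fst u) (snd u) = l))"
    by (simp add: occurrences_def sum_of_bool_eq)
  then show ?thesis by (simp add: sum.cartesian_product split_def del: sum_of_bool_eq)
qed

lemma card_filter_eq_sum: "finite S \<Longrightarrow> card {i \<in> S. P i} = (\<Sum>i\<in>S. of_bool (P i))"
  by (simp add: sum_of_bool_eq Int_def)

lemma card_filter_insert:
  assumes "finite S" "x \<notin> S"
  shows "card {i \<in> insert x S. P i} = of_bool (P x) + card {i \<in> S. P i}"
  using assms by (simp add: card_filter_eq_sum del: sum_of_bool_eq insert_iff)

lemma card_filter_atMost_Suc:
  "card {i \<in> {1..Suc m}. P i} = card {i \<in> {1..m}. P i} + of_bool (P (Suc m))"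
  unfolding card_filter_eq_sum[OF finite_atLeastAtMost] by (simp del: sum_of_bool_eq)

text \<open>The new row mirrors the new column, so each new occurrence off the diagonal counts
  twice.\<close>

lemma occurrences_Suc_symmetric:
  assumes "symmetric_array (Suc m) A"
  shows "occurrences (Suc m) A l =
    occurrences m A l + 2 * card {i \<in> {1..m}. A i (Suc m) = l} + of_bool (A (Suc m) (Suc m) = l)"
proof -
  have "(\<Sum>j\<in>{1..m}. of_bool (A (Suc m) j = l)) = (\<Sum>j\<in>{1..m}. of_bool (A j (Suc m) = l) :: nat)"
    using assms by (intro sum.cong) (auto simp: symmetric_array_def)
  then show ?thesis
    unfolding occurrences_eq_sum card_filter_eq_sum[OF finite_atLeastAtMost]
    by (simp add: sum.distrib del: sum_of_bool_eq)
qed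

lemma symmetric_array_mono: "symmetric_array m A \<Longrightarrow> m' \<le> m \<Longrightarrow> symmetric_array m' A"
  by (auto simp: symmetric_array_def)

text \<open>Off-diagonal occurrences pair up under transposition. This is the only source of the
  parity condition.\<close>

lemma even_occurrences_plus_diagonal:
  assumes "symmetric_array m A"
  shows "even (occurrences m A l + card {i \<in> {1..m}. A i i = l})"
  using assms
proof (induction m)
  case 0
  then show ?case by (simp add: occurrences_def)
next
  case (Suc m)
  have "symmetric_array m A" using Suc.prems by (rule symmetric_array_mono) simp
  then show ?case using Suc.IH
    unfolding card_filter_atMost_Suc occurrences_Suc_symmetric[OF Suc.prems] by simp
qed

lemma card_fibre_le_1_iff_inj_on:
  assumes "finite S" "f ` S \<subseteq> K"
  shows "(\<forall>l\<in>K. card {i \<in> S. f i = l} \<le> 1) \<longleftrightarrow> inj_on f S"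
proof
  assume *: "\<forall>l\<in>K. card {i \<in> S. f i = l} \<le> 1"
  show "inj_on f S"
  proof (rule inj_onI)
    fix x y assume xy: "x \<in> S" "y \<in> S" "f x = f y"
    then have "card {i \<in> S. f i = f x} \<le> Suc 0" using * assms by auto
    then show "x = y" using xy assms(1) by (subst (asm) card_le_Suc0_iff_eq) auto
  qed
next
  assume "inj_on f S"
  then show "\<forall>l\<in>K. card {i \<in> S. f i = l} \<le> 1"
    using assms(1) by (auto simp: card_le_Suc0_iff_eq dest: inj_onD)
qed

lemma symmetric_latin_array_iff:
  assumes "symmetric_array m A"
  shows "latin_array m k A \<longleftrightarrow> (\<forall>i\<in>{1..m}. A i ` {1..m} \<subseteq> {1..k} \<and> inj_on (A i) {1..m})"
proof -
  have col: "{i \<in> {1..m}. A i j = l} = {i \<in> {1..m}. A j i = l}" if "j \<in> {1..m}" for j l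
    using assms that by (auto simp: symmetric_array_def)
  have "(\<forall>j\<in>{1..m}. \<forall>l\<in>{1..k}. card {i \<in> {1..m}. A i j = l} \<le> 1) \<longleftrightarrow>
      (\<forall>j\<in>{1..m}. \<forall>l\<in>{1..k}. card {i \<in> {1..m}. A j i = l} \<le> 1)"
    by (intro ball_cong refl) (simp only: col)
  then have "latin_array m k A \<longleftrightarrow> (\<forall>i\<in>{1..m}. A i ` {1..m} \<subseteq> {1..k}) \<and>
     (\<forall>i\<in>{1..m}. \<forall>l\<in>{1..k}. card {j \<in> {1..m}. A i j = l} \<le> 1)"
    unfolding latin_array_def image_subset_iff by blast
  moreover have "(\<forall>l\<in>{1..k}. card {j \<in> {1..m}. A i j = l} \<le> 1) \<longleftrightarrow> inj_on (A i) {1..m}"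
    if "A i ` {1..m} \<subseteq> {1..k}" for i
    using that by (rule card_fibre_le_1_iff_inj_on[OF finite_atLeastAtMost])
  ultimately show ?thesis by meson
qed

section \<open>Outlines and their realisation row by row\<close>

text \<open>Here \<open>B i\<close> is the set of symbols still to be placed in row \<open>i\<close> outside \<open>L\<close>, and the
  \<open>m \<times> m\<close> bottom right corner receives each symbol \<open>l\<close> on \<open>f l\<close> diagonal and \<open>2 * g l\<close>
  off-diagonal cells.\<close>
definition outline ::
    "nat \<Rightarrow> nat \<Rightarrow> nat \<Rightarrow> arr \<Rightarrow> (nat \<Rightarrow> nat set) \<Rightarrow> (nat \<Rightarrow> nat) \<Rightarrow> (nat \<Rightarrow> nat) \<Rightarrow> bool" where
  "outline k r m L B f g \<longleftrightarrow>
     latin_array r k L \<and> symmetric_array r L \<and>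
     (\<forall>i\<in>{1..r}. B i \<subseteq> {1..k} \<and> card (B i) = m \<and> B i \<inter> L i ` {1..r} = {}) \<and>
     (\<Sum>l\<in>{1..k}. f l) = m \<and> (\<Sum>l\<in>{1..k}. 2 * g l) = m * (m - 1) \<and>
     (\<forall>l\<in>{1..k}. card {i \<in> {1..r}. l \<in> B i} + 2 * g l + f l \<le> m)"

text \<open>The symbols of the new row are chosen at once: \<open>c i\<close> for the cell in column \<open>i\<close>, \<open>c 0\<close> for
  the diagonal cell, and \<open>R\<close> for the cells beyond it. Each symbol \<open>l\<close> has
  \<open>card {i \<in> {1..r}. l \<in> B i} + 2 * g l + f l\<close> places left, and a symbol with \<open>Suc m\<close> places left
  is forced into the row.\<close>
lemma outline_choose_row:
  assumes o: "outline k r (Suc m) L B f g"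
  obtains c R where "\<forall>i\<in>{1..r}. c i \<in> B i" "c 0 \<in> {1..k}" "f (c 0) > 0"
    "R \<subseteq> {1..k}" "card R = m" "\<forall>l\<in>R. g l > 0"
    "inj_on c {0..r}" "c ` {0..r} \<inter> R = {}"
    "\<forall>l\<in>{1..k}. card {i \<in> {1..r}. l \<in> B i} + 2 * g l + f l = Suc m \<longrightarrow>
      l \<in> c ` {0..r} \<union> R"
proof -
  \<comment> \<open>Line \<open>0\<close> stands for the diagonal of the corner, lines
    \<open>1\<close> to \<open>r\<close> for the old rows, and line \<open>Suc r\<close> for the
    corner off its diagonal. Their sums are \<open>Suc m\<close>, \<open>Suc m\<close> and
    \<open>Suc m * m\<close>; dividing by \<open>Suc m\<close> asks for one symbol, one symbol each,
    and \<open>m\<close> symbols.\<close>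
  define w where "w i l = (if i = 0 then f l else if i = Suc r then 2 * g l else of_bool (l \<in> B i))"
    for i l
  have split: "(\<Sum>i\<in>{0..Suc r}. h i) = h 0 + (\<Sum>i\<in>{1..r}. h i) + h (Suc r)" for h :: "nat \<Rightarrow> nat"
    by (simp add: sum.atLeast_Suc_atMost)
  have colw: "(\<Sum>i\<in>{0..Suc r}. w i l) = card {i \<in> {1..r}. l \<in> B i} + 2 * g l + f l" for l
    unfolding split card_filter_eq_sum[OF finite_atLeastAtMost] by (simp add: w_def del: sum_of_bool_eq)
  obtain y :: "nat \<Rightarrow> nat \<Rightarrow> nat" where
    y: "\<forall>i\<in>{0..Suc r}. \<forall>l\<in>{1..k}. \<forall>s. w i l \<le> Suc m * s \<longrightarrow> y i l \<le> s"
    "\<forall>i\<in>{0..Suc r}. \<forall>s. (\<Sum>l\<in>{1..k}. w i l) = Suc m * s \<longrightarrow> (\<Sum>l\<in>{1..k}. y i l) = s"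
    "\<forall>l\<in>{1..k}. \<forall>s. (\<Sum>i\<in>{0..Suc r}. w i l) \<le> Suc m * s \<longrightarrow> (\<Sum>i\<in>{0..Suc r}. y i l) \<le> s"
    "\<forall>l\<in>{1..k}. \<forall>s. Suc m * s \<le> (\<Sum>i\<in>{0..Suc r}. w i l) \<longrightarrow> s \<le> (\<Sum>i\<in>{0..Suc r}. y i l)"
    using round_matrix_quotient[of "{0..Suc r}" "{1..k}" "Suc m" w] by blast
  have supp: "w i l > 0" if "i \<in> {0..Suc r}" "l \<in> {1..k}" "y i l > 0" for i l
    using y(1)[rule_format, OF that(1,2), of 0] that(3) by auto
  \<comment> \<open>No symbol has more than \<open>Suc m\<close> places left, so after rounding it
    is chosen at most once in total.\<close>
  have coly: "(\<Sum>i\<in>{0..Suc r}. y i l) \<le> 1" if "l \<in> {1..k}" for l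
    using y(3)[rule_format, OF that, of 1] o that unfolding colw by (simp add: outline_def)
  have y1: "y i l \<le> 1" if "i \<in> {0..Suc r}" "l \<in> {1..k}" for i l
    using coly[OF that(2)] member_le_sum[of i "{0..Suc r}" "\<lambda>i. y i l"] that(1) by auto
  have disj: "i = i'" if "i \<in> {0..Suc r}" "i' \<in> {0..Suc r}" "l \<in> {1..k}" "y i l > 0" "y i' l > 0" for i i' l
  proof (rule ccontr)
    assume "i \<noteq> i'"
    then have "y i l + y i' l = (\<Sum>i\<in>{i, i'}. y i l)" by simp
    also have "\<dots> \<le> (\<Sum>i\<in>{0..Suc r}. y i l)" using that by (intro sum_mono2) auto
    finally show False using coly[OF that(3)] that by linarith
  qed
  have roww: "(\<Sum>l\<in>{1..k}. w i l) = Suc m" if "i \<in> {0..r}" for i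
  proof (cases "i = 0")
    case True
    then show ?thesis using o by (simp add: w_def outline_def)
  next
    case False
    then have i: "i \<in> {1..r}" using that by auto
    then have "{1..k} \<inter> B i = B i" using o by (auto simp: outline_def)
    then show ?thesis using False that o i by (auto simp: w_def sum_of_bool_eq outline_def)
  qed
  have "\<exists>l\<in>{1..k}. y i l > 0" if "i \<in> {0..r}" for i
  proof -
    have "(\<Sum>l\<in>{1..k}. y i l) = 1" using y(2) roww[OF that] that by auto
    then show ?thesis by (metis bot_nat_0.not_eq_extremum sum.neutral zero_neq_one)
  qed
  then obtain c where c: "\<And>i. i \<in> {0..r} \<Longrightarrow> c i \<in> {1..k}" "\<And>i. i \<in> {0..r} \<Longrightarrow> y i (c i) > 0"
    by metis
  have uniq: "l = c i" if "i \<in> {0..r}" "l \<in> {1..k}" "y i l > 0" for i l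
  proof (rule ccontr)
    assume "l \<noteq> c i"
    then have "y i l + y i (c i) = (\<Sum>l\<in>{l, c i}. y i l)" by simp
    also have "\<dots> \<le> (\<Sum>l\<in>{1..k}. y i l)" using that c by (intro sum_mono2) auto
    also have "\<dots> = 1" using y(2) roww[OF that(1)] that by auto
    finally show False using c(2)[OF that(1)] that by linarith
  qed
  define R where "R = {l \<in> {1..k}. y (Suc r) l > 0}"
  have "(\<Sum>l\<in>{1..k}. w (Suc r) l) = Suc m * m"
    using o by (simp add: w_def outline_def)
  then have "(\<Sum>l\<in>{1..k}. y (Suc r) l) = m" using y(2) by auto
  moreover have "(\<Sum>l\<in>{1..k}. y (Suc r) l) = (\<Sum>l\<in>{1..k}. of_bool (y (Suc r) l > 0))"
  proof (rule sum.cong)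
    fix l assume "l \<in> {1..k}"
    then show "y (Suc r) l = of_bool (y (Suc r) l > 0)" using y1[of "Suc r" l] by (cases "y (Suc r) l") auto
  qed simp
  ultimately have cardR: "card R = m" unfolding R_def card_filter_eq_sum[OF finite_atLeastAtMost] by simp
  show thesis
  proof (rule that[of c R])
    show "\<forall>i\<in>{1..r}. c i \<in> B i"
    proof
      fix i assume "i \<in> {1..r}"
      then show "c i \<in> B i"
        using supp[of i "c i"] c[of i] by (auto simp: w_def split: if_splits)
    qed
    show "c 0 \<in> {1..k}" using c by simp
    show "f (c 0) > 0" using supp[of 0 "c 0"] c[of 0] by (simp add: w_def)
    show "R \<subseteq> {1..k}" by (auto simp: R_def)
    show "card R = m" by (fact cardR)
    show "\<forall>l\<in>R. g l > 0"
    proof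
      fix l assume "l \<in> R"
      then show "g l > 0" using supp[of "Suc r" l] by (auto simp: w_def R_def)
    qed
    show "inj_on c {0..r}"
    proof (rule inj_onI)
      fix i j assume "i \<in> {0..r}" "j \<in> {0..r}" "c i = c j"
      then show "i = j" using disj[of i j "c i"] c[of i] c[of j] by auto
    qed
    show "c ` {0..r} \<inter> R = {}"
    proof -
      have "c i \<notin> R" if "i \<in> {0..r}" for i
        using disj[of i "Suc r" "c i"] c[of i] that by (auto simp: R_def)
      then show ?thesis by blast
    qed
    show "\<forall>l\<in>{1..k}. card {i \<in> {1..r}. l \<in> B i} + 2 * g l + f l = Suc m \<longrightarrow>
      l \<in> c ` {0..r} \<union> R"
    proof (intro ballI impI)
      fix l assume l: "l \<in> {1..k}" "card {i \<in> {1..r}. l \<in> B i} + 2 * g l + f l = Suc m"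
      have "1 \<le> (\<Sum>i\<in>{0..Suc r}. y i l)" using y(4) l colw[of l] by auto
      then obtain i where i: "i \<in> {0..Suc r}" "y i l > 0"
        by (metis bot_nat_0.not_eq_extremum not_one_le_zero sum.neutral)
      show "l \<in> c ` {0..r} \<union> R"
      proof (cases "i = Suc r")
        case True
        then show ?thesis using i l by (simp add: R_def)
      next
        case False
        then have "i \<in> {0..r}" using i by auto
        then show ?thesis using uniq[of i l] i l by blast
      qed
    qed
  qed
qed

text \<open>The chosen symbols border \<open>L\<close> by a new row and its mirror image. A symbol
  of \<open>R\<close> is only committed to the new row: one of its off-diagonal pairs in the corner
  turns into a pending entry of \<open>B' (Suc r)\<close>. Pending entries count twice in the final
  total because each will be placed together with its mirror image, so that total is
  unchanged.\<close>

lemma outline_extend_row: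
  assumes o: "outline k r (Suc m) L B f g"
  obtains L' B' f' g' where "outline k (Suc r) m L' B' f' g'" "top_left_subarray r L L'"
    "\<forall>l\<in>{1..k}. f l = f' l + of_bool (L' (Suc r) (Suc r) = l)"
    "\<forall>l\<in>{1..k}.
      occurrences (Suc r) L' l + 2 * card {i \<in> {1..Suc r}. l \<in> B' i} + 2 * g' l + f' l =
      occurrences r L l + 2 * card {i \<in> {1..r}. l \<in> B i} + 2 * g l + f l"
proof -
  obtain c R where cB[rule_format]: "\<forall>i\<in>{1..r}. c i \<in> B i" and c0: "c 0 \<in> {1..k}" "f (c 0) > 0"
    and R: "R \<subseteq> {1..k}" "card R = m" "\<forall>l\<in>R. g l > 0"
    and cR: "inj_on c {0..r}" "c ` {0..r} \<inter> R = {}"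
    and full[rule_format]:
      "\<forall>l\<in>{1..k}. card {i \<in> {1..r}. l \<in> B i} + 2 * g l + f l = Suc m \<longrightarrow>
      l \<in> c ` {0..r} \<union> R"
    by (rule outline_choose_row[OF o])
  have B: "B i \<subseteq> {1..k}" "card (B i) = Suc m" "B i \<inter> L i ` {1..r} = {}" if "i \<in> {1..r}" for i
    using o that by (auto simp: outline_def)
  have L: "L i ` {1..r} \<subseteq> {1..k}" "inj_on (L i) {1..r}" if "i \<in> {1..r}" for i
    using o that symmetric_latin_array_iff[of r L k] by (auto simp: outline_def)
  have symL: "L i j = L j i" if "i \<in> {1..r}" "j \<in> {1..r}" for i j
    using o that by (auto simp: outline_def symmetric_array_def)
  define L' where "L' i j = (if i = Suc r then if j = Suc r then c 0 else c j
     else if j = Suc r then c i else L i j)" for i j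
  define B' where "B' i = (if i = Suc r then R else B i - {c i})" for i
  define f' where "f' l = f l - of_bool (c 0 = l)" for l
  define g' where "g' l = g l - of_bool (l \<in> R)" for l
  \<comment> \<open>Positivity of \<open>f (c 0)\<close> here, and of \<open>g\<close> on
    \<open>R\<close> below, makes the truncated subtractions exact.\<close>
  have f': "f l = f' l + of_bool (c 0 = l)" for l using c0 by (auto simp: f'_def)
  have g': "g l = g' l + of_bool (l \<in> R)" for l using R(3) by (auto simp: g'_def)
  have int: "{1..Suc r} = insert (Suc r) {1..r}" by auto
  have sym: "symmetric_array (Suc r) L'"
    using symL by (auto simp: symmetric_array_def L'_def)
  have cinj: "inj_on c {1..r}" by (rule inj_on_subset[OF cR(1)]) auto
  have c0': "c 0 \<notin> c ` {1..r}" using cR(1) by (auto dest!: inj_onD)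
  have cran: "c ` {1..r} \<subseteq> {1..k}" using cB B by blast
  have latin: "latin_array (Suc r) k L'"
    unfolding symmetric_latin_array_iff[OF sym]
  proof
    fix i assume i: "i \<in> {1..Suc r}"
    have img: "L' i ` {1..r} = (if i = Suc r then c ` {1..r} else L i ` {1..r})"
      by (auto simp: L'_def)
    have injr: "inj_on (L' i) {1..r}"
    proof (cases "i = Suc r")
      case True
      then have "inj_on (L' i) {1..r} \<longleftrightarrow> inj_on c {1..r}"
        by (intro inj_on_cong) (auto simp: L'_def)
      then show ?thesis using cinj by simp
    next
      case False
      then have "inj_on (L' i) {1..r} \<longleftrightarrow> inj_on (L i) {1..r}"
        by (intro inj_on_cong) (auto simp: L'_def)
      then show ?thesis using L(2)[of i] i False by simp
    qed
    have new: "L' i (Suc r) = (if i = Suc r then c 0 else c i)" by (simp add: L'_def)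
    have "L' i (Suc r) \<in> {1..k} - L' i ` {1..r}"
    proof (cases "i = Suc r")
      case True
      then show ?thesis using c0 c0' unfolding img new by simp
    next
      case False
      then have "i \<in> {1..r}" using i by auto
      then show ?thesis using False B[of i] cB[of i] unfolding img new by auto
    qed
    moreover have "L' i ` {1..r} \<subseteq> {1..k}"
      unfolding img using cran L(1)[of i] i by auto
    ultimately show "L' i ` {1..Suc r} \<subseteq> {1..k} \<and> inj_on (L' i) {1..Suc r}"
      unfolding int using injr by (auto simp: inj_on_insert)
  qed
  have B': "B' i \<subseteq> {1..k} \<and> card (B' i) = m \<and> B' i \<inter> L' i ` {1..Suc r} = {}"
    if i: "i \<in> {1..Suc r}" for i
  proof (cases "i = Suc r")
    case True
    have "L' i ` {1..Suc r} \<subseteq> c ` {0..r}" using True by (auto simp: L'_def)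
    moreover have "B' i = R" using True by (simp add: B'_def)
    ultimately show ?thesis using R cR by blast
  next
    case False
    then have i': "i \<in> {1..r}" using i by auto
    have "L' i ` {1..Suc r} = insert (c i) (L i ` {1..r})"
      unfolding int using False by (auto simp: L'_def)
    moreover have "finite (B i)" using B(1)[OF i'] finite_subset by blast
    ultimately show ?thesis using False B[OF i'] cB[OF i'] by (auto simp: B'_def)
  qed
  have bsplit: "card {i \<in> {1..r}. l \<in> B i} = card {i \<in> {1..r}. l \<in> B i - {c i}} + card {i \<in> {1..r}. c i = l}" for l
  proof -
    have "{i \<in> {1..r}. l \<in> B i} = {i \<in> {1..r}. l \<in> B i - {c i}} \<union> {i \<in> {1..r}. c i = l}"
      using cB by auto
    moreover have "{i \<in> {1..r}. l \<in> B i - {c i}} \<inter> {i \<in> {1..r}. c i = l} = {}" by auto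
    ultimately show ?thesis by (simp add: card_Un_disjoint)
  qed
  have b': "card {i \<in> {1..Suc r}. l \<in> B' i} = card {i \<in> {1..r}. l \<in> B i - {c i}} + of_bool (l \<in> R)" for l
  proof -
    have old: "{i \<in> {1..r}. l \<in> B' i} = {i \<in> {1..r}. l \<in> B i - {c i}}" by (auto simp: B'_def)
    show ?thesis unfolding card_filter_atMost_Suc old by (simp add: B'_def)
  qed
  have deg: "card {i \<in> {1..Suc r}. l \<in> B' i} + 2 * g' l + f' l \<le> m" if l: "l \<in> {1..k}" for l
  proof -
    \<comment> \<open>Each of the three ways of being chosen uses up one place; for \<open>l\<close>
      in \<open>R\<close>, \<open>2 * g l\<close> drops by two while the number of pending rows
      grows by one. Symbols with \<open>Suc m\<close> places left are all chosen, so the bound falls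
      to \<open>m\<close>.\<close>
    have eq: "card {i \<in> {1..r}. l \<in> B i} + 2 * g l + f l = card {i \<in> {1..Suc r}. l \<in> B' i} + 2 * g' l + f' l
      + (card {i \<in> {1..r}. c i = l} + of_bool (c 0 = l) + of_bool (l \<in> R))"
      unfolding b' bsplit f' g' by simp
    have le: "card {i \<in> {1..r}. l \<in> B i} + 2 * g l + f l \<le> Suc m"
      using o l by (simp add: outline_def)
    show ?thesis
    proof (cases "card {i \<in> {1..r}. l \<in> B i} + 2 * g l + f l = Suc m")
      case True
      then consider "l \<in> R" | "l = c 0" | i where "i \<in> {1..r}" "c i = l"
        using full[OF l] by (auto simp: Suc_le_eq) (metis gr0I)
      then have "card {i \<in> {1..r}. c i = l} + of_bool (c 0 = l) + of_bool (l \<in> R) \<ge> (1::nat)"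
      proof cases
        case 3
        then have "card {i \<in> {1..r}. c i = l} > 0" by (auto simp: card_gt_0_iff)
        then show ?thesis by simp
      qed auto
      then show ?thesis using True eq by linarith
    next
      case False
      then show ?thesis using eq le by linarith
    qed
  qed
  have sumf: "(\<Sum>l\<in>{1..k}. f' l) = m"
  proof -
    have "(\<Sum>l\<in>{1..k}. f l) = (\<Sum>l\<in>{1..k}. f' l) + (\<Sum>l\<in>{1..k}. of_bool (c 0 = l))"
      unfolding f' by (simp add: sum.distrib)
    moreover have "(\<Sum>l\<in>{1..k}. of_bool (c 0 = l)) = (1::nat)"
      using c0 by (simp add: of_bool_def)
    ultimately show ?thesis using o by (simp add: outline_def)
  qed
  have sumg: "(\<Sum>l\<in>{1..k}. 2 * g' l) = m * (m - 1)"
  proof -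
    have "(\<Sum>l\<in>{1..k}. 2 * g l) = (\<Sum>l\<in>{1..k}. 2 * g' l) + 2 * (\<Sum>l\<in>{1..k}. of_bool (l \<in> R))"
      unfolding g' by (simp add: sum.distrib sum_distrib_left)
    moreover have "(\<Sum>l\<in>{1..k}. of_bool (l \<in> R)) = m"
      using R by (simp add: sum_of_bool_eq Int_absorb1)
    moreover have "(\<Sum>l\<in>{1..k}. 2 * g l) = Suc m * m" using o by (simp add: outline_def)
    ultimately show ?thesis by (cases m) auto
  qed
  show thesis
  proof (rule that[of L' B' f' g'])
    show "outline k (Suc r) m L' B' f' g'"
      unfolding outline_def using sym latin B' deg sumf sumg by blast
    show "top_left_subarray r L L'" by (simp add: top_left_subarray_def L'_def)
    show "\<forall>l\<in>{1..k}. f l = f' l + of_bool (L' (Suc r) (Suc r) = l)" by (simp add: L'_def f')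
    show "\<forall>l\<in>{1..k}.
      occurrences (Suc r) L' l + 2 * card {i \<in> {1..Suc r}. l \<in> B' i} + 2 * g' l + f' l =
      occurrences r L l + 2 * card {i \<in> {1..r}. l \<in> B i} + 2 * g l + f l"
    proof
    fix l assume "l \<in> {1..k}"
    have "occurrences r L' l = occurrences r L l"
      unfolding occurrences_eq_sum by (intro sum.cong) (auto simp: L'_def)
    moreover have "{i \<in> {1..r}. L' i (Suc r) = l} = {i \<in> {1..r}. c i = l}" by (auto simp: L'_def)
    moreover have "L' (Suc r) (Suc r) = c 0" by (simp add: L'_def)
    ultimately show "occurrences (Suc r) L' l + 2 * card {i \<in> {1..Suc r}. l \<in> B' i} + 2 * g' l + f' l =
      occurrences r L l + 2 * card {i \<in> {1..r}. l \<in> B i} + 2 * g l + f l"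
      unfolding occurrences_Suc_symmetric[OF sym] b' bsplit f' g' by simp
    qed
  qed
qed

text \<open>Induction on the size of the corner, which shrinks by one as a row is added. At size
  zero the bound on the places left forces \<open>f\<close> and \<open>g\<close> to vanish and
  nothing is pending.\<close>

lemma outline_completion:
  assumes "outline k r m L B f g"
  shows "\<exists>L'. latin_array (r + m) k L' \<and> symmetric_array (r + m) L' \<and> top_left_subarray r L L' \<and>
    (\<forall>l\<in>{1..k}. occurrences (r + m) L' l =
      occurrences r L l + 2 * card {i \<in> {1..r}. l \<in> B i} + 2 * g l + f l) \<and>
    (\<forall>l\<in>{1..k}. card {i \<in> {r + 1..r + m}. L' i i = l} = f l)"
  using assms
proof (induction m arbitrary: r L B f g)
  case 0
  then have "B i = {}" if "i \<in> {1..r}" for i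
    using that card_0_eq[OF finite_subset[of "B i" "{1..k}"]] by (simp add: outline_def)
  then have "{i \<in> {1..r}. l \<in> B i} = {}" for l by auto
  with 0 show ?case by (intro exI[of _ L]) (auto simp: outline_def top_left_subarray_def)
next
  case (Suc m)
  obtain L1 B1 f1 g1 where 1: "outline k (Suc r) m L1 B1 f1 g1" "top_left_subarray r L L1"
    "\<forall>l\<in>{1..k}. f l = f1 l + of_bool (L1 (Suc r) (Suc r) = l)"
    "\<forall>l\<in>{1..k}.
      occurrences (Suc r) L1 l + 2 * card {i \<in> {1..Suc r}. l \<in> B1 i} + 2 * g1 l + f1 l =
      occurrences r L l + 2 * card {i \<in> {1..r}. l \<in> B i} + 2 * g l + f l"
    by (rule outline_extend_row[OF Suc.prems])
  obtain L' where L': "latin_array (Suc r + m) k L'" "symmetric_array (Suc r + m) L'"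
    "top_left_subarray (Suc r) L1 L'"
    "\<forall>l\<in>{1..k}. occurrences (Suc r + m) L' l =
      occurrences (Suc r) L1 l + 2 * card {i \<in> {1..Suc r}. l \<in> B1 i} + 2 * g1 l + f1 l"
    "\<forall>l\<in>{1..k}. card {i \<in> {Suc r + 1..Suc r + m}. L' i i = l} = f1 l"
    using Suc.IH[OF 1(1)] by blast
  have eq: "Suc r + m = r + Suc m" by simp
  have diag: "card {i \<in> {r + 1..r + Suc m}. L' i i = l} = f l" if l: "l \<in> {1..k}" for l
  proof -
    have ins: "{r + 1..r + Suc m} = insert (Suc r) {Suc r + 1..Suc r + m}" by auto
    have "card {i \<in> {r + 1..r + Suc m}. L' i i = l} =
        of_bool (L' (Suc r) (Suc r) = l) + card {i \<in> {Suc r + 1..Suc r + m}. L' i i = l}"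
      unfolding ins by (rule card_filter_insert) auto
    moreover have "L' (Suc r) (Suc r) = L1 (Suc r) (Suc r)"
      using L'(3) by (simp add: top_left_subarray_def)
    ultimately show ?thesis using L'(5) 1(3) l by simp
  qed
  show ?case
    using L' 1(2,4) diag unfolding eq
    by (intro exI[of _ L']) (auto simp: top_left_subarray_def)
qed

section \<open>Completion with a prescribed diagonal tail\<close>

text \<open>Greedy choice: each element takes as much of the remaining total as its capacity
  allows.\<close>

lemma sum_prescribed_total:
  fixes h :: "'a \<Rightarrow> nat"
  assumes "finite S" "T \<le> sum h S"
  shows "\<exists>t. (\<forall>l\<in>S. t l \<le> h l) \<and> sum t S = T"
  using assms
proof (induction S arbitrary: T rule: finite_induct)
  case empty
  then show ?case by simp
next
  case (insert x S)
  then have "T - min T (h x) \<le> sum h S" by simp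
  then obtain t where t: "\<forall>l\<in>S. t l \<le> h l" "sum t S = T - min T (h x)"
    using insert.IH by blast
  have "sum (t(x := min T (h x))) S = sum t S" using insert.hyps by (intro sum.cong) auto
  then show ?case using t insert.hyps by (intro exI[of _ "t(x := min T (h x))"]) auto
qed

lemma sum_card_fibres:
  assumes "finite S" "finite K" "f ` S \<subseteq> K"
  shows "(\<Sum>l\<in>K. card {i \<in> S. f i = l}) = card S"
  using sum.group[OF assms, of "\<lambda>_. 1::nat"] by simp

lemma sum_occurrences:
  assumes "latin_array m k A"
  shows "(\<Sum>l\<in>{1..k}. occurrences m A l) = m * m"
proof -
  have "occurrences m A l = card {u \<in> {1..m} \<times> {1..m}. A (fst u) (snd u) = l}" for l
    unfolding occurrences_def by (intro arg_cong[of _ _ card]) auto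
  moreover have "(\<lambda>u. A (fst u) (snd u)) ` ({1..m} \<times> {1..m}) \<subseteq> {1..k}"
    using assms by (auto simp: latin_array_def)
  ultimately show ?thesis
    using sum_card_fibres[of "{1..m} \<times> {1..m}" "{1..k}" "\<lambda>u. A (fst u) (snd u)"] by simp
qed

text \<open>A symbol appears at most once in a row. Consequently \<open>r - e l\<close> counts the
  rows of \<open>L\<close> that miss \<open>l\<close>.\<close>

lemma occurrences_eq_card_rows:
  assumes "symmetric_array m A" "latin_array m k A"
  shows "occurrences m A l = card {i \<in> {1..m}. l \<in> A i ` {1..m}}"
proof -
  have inj: "inj_on (A i) {1..m}" if "i \<in> {1..m}" for i
    using assms(2) that unfolding symmetric_latin_array_iff[OF assms(1)] by blast
  have "(\<Sum>j\<in>{1..m}. of_bool (A i j = l)) = (of_bool (l \<in> A i ` {1..m}) :: nat)" if "i \<in> {1..m}" for i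
  proof (cases "l \<in> A i ` {1..m}")
    case True
    then obtain j0 where j0: "j0 \<in> {1..m}" "A i j0 = l" by auto
    then have "{1..m} \<inter> {j. A i j = l} = {j0}"
      using inj[OF that] unfolding inj_on_def by blast
    then show ?thesis using True by (simp add: sum_of_bool_eq)
  next
    case False
    then have "{1..m} \<inter> {j. A i j = l} = {}" by auto
    then show ?thesis using False by (simp add: sum_of_bool_eq)
  qed
  then show ?thesis unfolding occurrences_eq_sum card_filter_eq_sum[OF finite_atLeastAtMost]
    by (intro sum.cong) auto
qed

text \<open>The summand is the least number of tail cells of symbol \<open>l\<close> that respects
  both the prescription \<open>d l\<close> and the parity of the diagonal.\<close>

lemma sum_minimum_diagonal:
  fixes d p :: "nat \<Rightarrow> nat"
  assumes "D = (\<Sum>l\<in>{1..k}. d l)" "q = card {l \<in> {1..k}. odd (p l)}"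
  shows "(\<Sum>l\<in>{1..k}. d l + of_bool (odd (p l))) = D + q"
  unfolding assms by (simp only: sum.distrib finite_atLeastAtMost card_filter_eq_sum)

section \<open>Necessity: the parity of the diagonal tail\<close>

text \<open>Comparing the diagonal parities of \<open>L\<close> and \<open>L'\<close> shows that the
  tail count of \<open>l\<close> has the parity of \<open>\<rho> l + e l\<close>. Being at least
  \<open>d l\<close>, it exceeds the parity-corrected minimum by an even number; summing over the
  symbols counts all tail cells.\<close>

lemma completion_imp_slack_even:
  assumes "r \<le> n" "symmetric_array n L'" "latin_array n k L'" "top_left_subarray r L L'"
    and "prescribed_diagonal_tail r n k d L'"
    and \<rho>: "\<And>l. l \<in> {1..k} \<Longrightarrow> occurrences n L' l = \<rho> l"
    and e: "\<And>l. l \<in> {1..k} \<Longrightarrow> e l = occurrences r L l"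
    and "D = (\<Sum>l\<in>{1..k}. d l)" "q = card {l \<in> {1..k}. odd (\<rho> l + e l + d l)}"
  shows "\<exists>s. n - r = D + q + 2 * s"
proof -
  define t where "t l = card {i \<in> {r + 1..n}. L' i i = l}" for l
  have "\<exists>s. t l = d l + of_bool (odd (\<rho> l + e l + d l)) + 2 * s" if l: "l \<in> {1..k}" for l
  proof -
    have "{i \<in> {1..n}. L' i i = l} = {i \<in> {1..r}. L' i i = l} \<union> {i \<in> {r + 1..n}. L' i i = l}"
      using assms(1) by auto
    moreover have "{i \<in> {1..r}. L' i i = l} \<inter> {i \<in> {r + 1..n}. L' i i = l} = {}" by auto
    ultimately have diag: "card {i \<in> {1..n}. L' i i = l} = card {i \<in> {1..r}. L' i i = l} + t l"
      by (simp add: card_Un_disjoint t_def)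
    have "occurrences r L' l = e l"
      unfolding e[OF l] occurrences_eq_sum using assms(4)
      by (intro sum.cong refl) (auto simp: top_left_subarray_def)
    then have "even (e l + card {i \<in> {1..r}. L' i i = l})"
      using even_occurrences_plus_diagonal[OF symmetric_array_mono[OF assms(2,1)], of l] by simp
    then have par: "even (\<rho> l + e l + t l)"
      using even_occurrences_plus_diagonal[OF assms(2), of l] \<rho>[OF l] unfolding diag by auto
    have le: "d l \<le> t l" using assms(5) l by (simp add: prescribed_diagonal_tail_def t_def)
    have "d l + of_bool (odd (\<rho> l + e l + d l)) \<le> t l"
      using par le by (cases "d l = t l") auto
    moreover have "even (t l - (d l + of_bool (odd (\<rho> l + e l + d l))))"
      using calculation par by simp
    ultimately show ?thesis by (metis dvdE le_add_diff_inverse)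
  qed
  then obtain s where s: "\<And>l. l \<in> {1..k} \<Longrightarrow> t l = d l + of_bool (odd (\<rho> l + e l + d l)) + 2 * s l"
    by metis
  have "n - r = card {r + 1..n}" by simp
  also have "\<dots> = (\<Sum>l\<in>{1..k}. t l)"
    unfolding t_def using assms(3)
    by (intro sum_card_fibres[symmetric]) (auto simp: latin_array_def)
  also have "\<dots> = (\<Sum>l\<in>{1..k}. d l + of_bool (odd (\<rho> l + e l + d l)) + 2 * s l)"
    by (intro sum.cong s) auto
  also have "\<dots> = D + q + 2 * (\<Sum>l\<in>{1..k}. s l)"
    unfolding sum.distrib[of "\<lambda>l. d l + of_bool (odd (\<rho> l + e l + d l))"]
      sum_minimum_diagonal[OF assms(8,9)] by (simp only: sum_distrib_left)
  finally show ?thesis by blast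
qed

section \<open>Sufficiency: the symbols of the old rows and the corner\<close>

text \<open>Giving every missing pair of row and symbol the weight \<open>(n - r) / (k - r)\<close> distributes
  \<open>n - r\<close> symbols to each row fractionally; the hypotheses \<open>low\<close> and \<open>up\<close> say that the symbol totals of
  this distribution satisfy the bounds.\<close>
lemma choose_row_symbols:
  fixes lo up :: "nat \<Rightarrow> int"
  assumes "r < n" "n \<le> k" "symmetric_array r L" "latin_array r k L"
    and e: "\<And>l. l \<in> {1..k} \<Longrightarrow> e l = occurrences r L l"
    and low: "\<And>l. l \<in> {1..k} \<Longrightarrow> (int k - int r) * lo l \<le> (int n - int r) * (int r - int (e l))"
    and up: "\<And>l. l \<in> {1..k} \<Longrightarrow> (int n - int r) * (int r - int (e l)) \<le> (int k - int r) * up l"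
  shows "\<exists>B. (\<forall>i\<in>{1..r}. B i \<subseteq> {1..k} \<and> card (B i) = n - r \<and> B i \<inter> L i ` {1..r} = {}) \<and>
    (\<forall>l\<in>{1..k}. lo l \<le> int (card {i \<in> {1..r}. l \<in> B i}) \<and>
      int (card {i \<in> {1..r}. l \<in> B i}) \<le> up l)"
proof -
  define w where "w i l = (n - r) * of_bool (l \<notin> L i ` {1..r})" for i l
  have kr: "k - r > 0" "int (k - r) = int k - int r" "int (n - r) = int n - int r"
    using assms by auto
  obtain y :: "nat \<Rightarrow> nat \<Rightarrow> nat" where
    y: "\<forall>i\<in>{1..r}. \<forall>l\<in>{1..k}. \<forall>s. w i l \<le> (k - r) * s \<longrightarrow> y i l \<le> s"
    "\<forall>i\<in>{1..r}. \<forall>s. (\<Sum>l\<in>{1..k}. w i l) = (k - r) * s \<longrightarrow> (\<Sum>l\<in>{1..k}. y i l) = s"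
    "\<forall>l\<in>{1..k}. \<forall>s. (\<Sum>i\<in>{1..r}. w i l) \<le> (k - r) * s \<longrightarrow> (\<Sum>i\<in>{1..r}. y i l) \<le> s"
    "\<forall>l\<in>{1..k}. \<forall>s. (k - r) * s \<le> (\<Sum>i\<in>{1..r}. w i l) \<longrightarrow> s \<le> (\<Sum>i\<in>{1..r}. y i l)"
    using round_matrix_quotient[of "{1..r}" "{1..k}" "k - r" w] kr by blast
  have L: "L i ` {1..r} \<subseteq> {1..k}" "inj_on (L i) {1..r}" if "i \<in> {1..r}" for i
    using that assms symmetric_latin_array_iff[of r L k] by auto
  have y1: "y i l \<le> 1" if "i \<in> {1..r}" "l \<in> {1..k}" for i l
  proof -
    \<comment> \<open>As \<open>n \<le> k\<close>, every weight is at most one, so each symbol is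
      given to a row at most once.\<close>
    have "w i l \<le> (k - r) * 1" using assms(1,2) by (auto simp: w_def)
    then show ?thesis using y(1) that by blast
  qed
  have y0: "y i l = 0" if "i \<in> {1..r}" "l \<in> {1..k}" "l \<in> L i ` {1..r}" for i l
    using y(1)[rule_format, OF that(1,2), of 0] that by (simp add: w_def)
  have ybool: "y i l = of_bool (y i l > 0)" if "i \<in> {1..r}" "l \<in> {1..k}" for i l
    using y1[OF that] by (cases "y i l") auto
  have rowy: "(\<Sum>l\<in>{1..k}. y i l) = n - r" if "i \<in> {1..r}" for i
  proof -
    have "(\<Sum>l\<in>{1..k}. w i l) = (n - r) * (\<Sum>l\<in>{1..k}. of_bool (l \<notin> L i ` {1..r}))"
      unfolding w_def sum_distrib_left ..
    also have "(\<Sum>l\<in>{1..k}. of_bool (l \<notin> L i ` {1..r})) = card ({1..k} - L i ` {1..r})"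
      by (simp add: sum_of_bool_eq Diff_eq Compl_eq)
    also have "\<dots> = k - r" using L[OF that] by (subst card_Diff_subset) (auto simp: card_image)
    finally have "(\<Sum>l\<in>{1..k}. w i l) = (k - r) * (n - r)" by (simp add: mult.commute)
    then show ?thesis using y(2) that by blast
  qed
  have colw: "int (\<Sum>i\<in>{1..r}. w i l) = (int n - int r) * (int r - int (e l))" if "l \<in> {1..k}" for l
  proof -
    have "(\<Sum>i\<in>{1..r}. w i l) = (n - r) * (\<Sum>i\<in>{1..r}. of_bool (l \<notin> L i ` {1..r}))"
      unfolding w_def sum_distrib_left ..
    also have "(\<Sum>i\<in>{1..r}. of_bool (l \<notin> L i ` {1..r})) = card ({1..r} - {i \<in> {1..r}. l \<in> L i ` {1..r}})"
      unfolding card_filter_eq_sum[OF finite_atLeastAtMost, symmetric]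
      by (intro arg_cong[of _ _ card]) auto
    also have "\<dots> = r - e l"
      unfolding e[OF that] occurrences_eq_card_rows[OF assms(3,4)] by (subst card_Diff_subset) auto
    finally have *: "(\<Sum>i\<in>{1..r}. w i l) = (n - r) * (r - e l)" .
    have "e l \<le> card {1..r}"
      unfolding e[OF that] occurrences_eq_card_rows[OF assms(3,4)] by (intro card_mono) auto
    then show ?thesis unfolding * using assms(1) by (simp add: of_nat_diff)
  qed
  define B where "B i = {l \<in> {1..k}. y i l > 0}" for i
  have coly: "card {i \<in> {1..r}. l \<in> B i} = (\<Sum>i\<in>{1..r}. y i l)" if "l \<in> {1..k}" for l
    unfolding card_filter_eq_sum[OF finite_atLeastAtMost] B_def
    using ybool that by (intro sum.cong) auto
  show ?thesis
  proof (intro exI[of _ B] conjI ballI)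
    show "B i \<subseteq> {1..k}" for i by (auto simp: B_def)
    show "card (B i) = n - r" if "i \<in> {1..r}" for i
    proof -
      have "card (B i) = (\<Sum>l\<in>{1..k}. y i l)"
        unfolding B_def card_filter_eq_sum[OF finite_atLeastAtMost]
        using ybool that by (intro sum.cong) auto
      then show ?thesis using rowy[OF that] by simp
    qed
    show "B i \<inter> L i ` {1..r} = {}" if "i \<in> {1..r}" for i
      using y0[OF that] by (auto simp: B_def)
    fix l assume l: "l \<in> {1..k}"
    show "lo l \<le> int (card {i \<in> {1..r}. l \<in> B i})"
    \<comment> \<open>The rounding bounds speak of natural numbers; a negative lower bound holds
      trivially.\<close>
    proof (cases "lo l \<ge> 0")
      case True
      have "int ((k - r) * nat (lo l)) \<le> int (\<Sum>i\<in>{1..r}. w i l)"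
        unfolding colw[OF l] of_nat_mult kr using low[OF l] True by simp
      then have "(k - r) * nat (lo l) \<le> (\<Sum>i\<in>{1..r}. w i l)" by (simp only: of_nat_le_iff)
      then have "nat (lo l) \<le> (\<Sum>i\<in>{1..r}. y i l)" using y(4) l by blast
      then show ?thesis unfolding coly[OF l] by linarith
    qed simp
    have "0 \<le> int (\<Sum>i\<in>{1..r}. w i l)" by (rule of_nat_0_le_iff)
    also have "\<dots> \<le> (int k - int r) * up l" using up[OF l] unfolding colw[OF l] .
    finally have up0: "0 \<le> up l" using assms(1,2) by (simp add: zero_le_mult_iff)
    have "int (\<Sum>i\<in>{1..r}. w i l) \<le> int ((k - r) * nat (up l))"
      unfolding colw[OF l] of_nat_mult kr using up[OF l] up0 by simp
    then have "(\<Sum>i\<in>{1..r}. w i l) \<le> (k - r) * nat (up l)" by (simp only: of_nat_le_iff)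
    then have "(\<Sum>i\<in>{1..r}. y i l) \<le> nat (up l)" using y(3) l by blast
    then show "int (card {i \<in> {1..r}. l \<in> B i}) \<le> up l" unfolding coly[OF l] using up0 by linarith
  qed
qed

theorem corollary4p4:
  fixes n k r D q :: nat
    and \<rho> d e :: "nat \<Rightarrow> nat"
    and L :: arr
  assumes "n > 0" and "k > 0" and "r < n"
    and "\<forall>l\<in>{1..k}. 1 \<le> \<rho> l \<and> \<rho> l \<le> n" and "n \<le> k"
    and "(\<Sum>l\<in>{1..k}. \<rho> l) = n ^ 2"
    and "D = (\<Sum>l\<in>{1..k}. d l)" and "D \<le> n - r"
    and "rho_latin_rectangle r k \<rho> L" and "symmetric_array r L"
    and "\<forall>l\<in>{1..k}. e l = occurrences r L l"
    and "q = card {l \<in> {1..k}. odd (\<rho> l + e l + d l)}"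
    and "\<forall>l\<in>{1..k}.
           (int k - int r) * \<lfloor>(real (\<rho> l) - real (e l) - real (d l)) / 2\<rfloor>
             \<ge> (int n - int r) * (int r - int (e l)) \<and>
           (int n - int r) * (int r - int (e l))
             \<ge> (int k - int r) * (int (\<rho> l) - int (e l) - int n + int r)"
    and "\<forall>l\<in>{1..k}. \<forall>l'\<in>{1..k}.
           (int r - int (e l')) * \<lfloor>(real (\<rho> l) - real (e l) - real (d l)) / 2\<rfloor>
             \<ge> (int r - int (e l)) * (int (\<rho> l') - int (e l') - int n + int r)"
  shows "(\<exists>L'. rho_latin_square n k \<rho> L' \<and> symmetric_array n L' \<and>
               top_left_subarray r L L' \<and> prescribed_diagonal_tail r n k d L')
         \<longleftrightarrow> (real n - real r - real D - real q) / 2 \<in> \<nat>"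
proof
  assume "\<exists>L'. rho_latin_square n k \<rho> L' \<and> symmetric_array n L' \<and>
               top_left_subarray r L L' \<and> prescribed_diagonal_tail r n k d L'"
  then obtain L' where "rho_latin_square n k \<rho> L'" "symmetric_array n L'"
    "top_left_subarray r L L'" "prescribed_diagonal_tail r n k d L'" by blast
  then obtain s where "n - r = D + q + 2 * s"
    using completion_imp_slack_even[of r n L' k L d \<rho> e D q] assms
    by (auto simp: rho_latin_square_def)
  then have "n = r + D + q + 2 * s" using assms(3) by linarith
  then have "(real n - real r - real D - real q) / 2 = real s" by simp
  then show "(real n - real r - real D - real q) / 2 \<in> \<nat>" by simp
next
  assume "(real n - real r - real D - real q) / 2 \<in> \<nat>"
  then obtain T where "(real n - real r - real D - real q) / 2 = real T" by (auto elim: Nats_cases)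
  then have "real n = real (r + D + q + 2 * T)" by (simp add: field_simps)
  \<comment> \<open>\<open>T\<close> is the number of surplus pairs of tail cells beyond the minimum
    \<open>D + q\<close>.\<close>
  then have T: "n = r + D + q + 2 * T" by (simp only: of_nat_eq_iff)
  define m where "m = n - r"
  have m: "n = r + m" "m = D + q + 2 * T" using assms(3) T by (auto simp: m_def)
  have lat: "latin_array r k L" using assms(9) by (simp add: rho_latin_rectangle_def)
  have "\<exists>B. (\<forall>i\<in>{1..r}. B i \<subseteq> {1..k} \<and> card (B i) = n - r \<and> B i \<inter> L i ` {1..r} = {}) \<and>
    (\<forall>l\<in>{1..k}. int (\<rho> l) - int (e l) - int n + int r \<le> int (card {i \<in> {1..r}. l \<in> B i}) \<and>
      int (card {i \<in> {1..r}. l \<in> B i}) \<le> \<lfloor>(real (\<rho> l) - real (e l) - real (d l)) / 2\<rfloor>)"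
  proof (rule choose_row_symbols[OF assms(3,5,10) lat])
    fix l assume l: "l \<in> {1..k}"
    show "e l = occurrences r L l" using assms(11) l by blast
    show "(int k - int r) * (int (\<rho> l) - int (e l) - int n + int r)
        \<le> (int n - int r) * (int r - int (e l))"
      "(int n - int r) * (int r - int (e l))
        \<le> (int k - int r) * \<lfloor>(real (\<rho> l) - real (e l) - real (d l)) / 2\<rfloor>"
      using assms(13) l by blast+
  qed
  then obtain B where B:
    "\<forall>i\<in>{1..r}. B i \<subseteq> {1..k} \<and> card (B i) = m \<and> B i \<inter> L i ` {1..r} = {}"
    "\<forall>l\<in>{1..k}. int (\<rho> l) - int (e l) - int n + int r \<le> int (card {i \<in> {1..r}. l \<in> B i}) \<and>
      int (card {i \<in> {1..r}. l \<in> B i}) \<le> \<lfloor>(real (\<rho> l) - real (e l) - real (d l)) / 2\<rfloor>"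
    unfolding m_def by blast
  define b where "b l = card {i \<in> {1..r}. l \<in> B i}" for l
  define p where "p l = (of_bool (odd (\<rho> l + e l + d l)) :: nat)" for l
  \<comment> \<open>Outside \<open>L\<close> and the \<open>2 * b l\<close> cells bordering it,
    \<open>l\<close> needs at least \<open>d l + p l\<close> diagonal cells; the remaining copies
    come in \<open>h l\<close> pairs. The floor in the upper bound on \<open>b l\<close> leaves room
    for \<open>d l\<close>, and parity then supplies \<open>p l\<close>.\<close>
  have "\<exists>h. \<rho> l = e l + 2 * b l + d l + p l + 2 * h" if l: "l \<in> {1..k}" for l
  proof -
    have "real (b l) \<le> (real (\<rho> l) - real (e l) - real (d l)) / 2"
      using B(2) l by (simp add: b_def le_floor_iff)
    then have "real (e l + 2 * b l + d l) \<le> real (\<rho> l)" by simp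
    then have "e l + 2 * b l + d l \<le> \<rho> l" by (simp only: of_nat_le_iff)
    then obtain h' where h': "\<rho> l = e l + 2 * b l + d l + h'" using le_Suc_ex by blast
    then have "odd (\<rho> l + e l + d l) \<longleftrightarrow> odd h'" by simp
    then have "h' = p l + 2 * (h' div 2)" by (simp add: p_def mod2_eq_if)
    then show ?thesis using h' by (metis add.assoc)
  qed
  then obtain h where h: "\<And>l. l \<in> {1..k} \<Longrightarrow> \<rho> l = e l + 2 * b l + d l + p l + 2 * h l" by metis
  have sumdo: "(\<Sum>l\<in>{1..k}. d l + p l) = D + q"
    unfolding p_def by (rule sum_minimum_diagonal[OF assms(7,12)])
  have sumb: "(\<Sum>l\<in>{1..k}. b l) = r * m"
  proof -
    have "(\<Sum>l\<in>{1..k}. b l) = (\<Sum>i\<in>{1..r}. \<Sum>l\<in>{1..k}. of_bool (l \<in> B i))"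
      unfolding b_def card_filter_eq_sum[OF finite_atLeastAtMost] by (rule sum.swap)
    also have "\<dots> = (\<Sum>i\<in>{1..r}. m)"
      using B(1) by (intro sum.cong) (auto simp: sum_of_bool_eq Int_absorb1)
    finally show ?thesis by simp
  qed
  have sume: "(\<Sum>l\<in>{1..k}. e l) = r * r" using sum_occurrences[OF lat] assms(11) by simp
  \<comment> \<open>Counting all cells by symbol and removing those in the first \<open>r\<close>
    rows or columns leaves the \<open>m * m\<close> cells of the corner.\<close>
  have "n ^ 2 = (\<Sum>l\<in>{1..k}. e l + 2 * b l + (d l + p l) + 2 * h l)"
    unfolding assms(6)[symmetric] by (intro sum.cong) (auto simp: h)
  also have "\<dots> = r * r + 2 * (r * m) + (D + q) + 2 * (\<Sum>l\<in>{1..k}. h l)"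
    unfolding sum.distrib sum_distrib_left[symmetric] sumb sume
    using sumdo unfolding sum.distrib by simp
  finally have sumh: "m * m = D + q + 2 * (\<Sum>l\<in>{1..k}. h l)"
    unfolding m(1) by (simp add: power2_eq_square algebra_simps)
  have "m \<le> m * m" by (cases m) auto
  \<comment> \<open>The \<open>m\<close> diagonal cells are among the \<open>m * m\<close> corner
    cells, so there are enough pairs to fill the rest of the diagonal.\<close>
  then have "T \<le> (\<Sum>l\<in>{1..k}. h l)" using sumh m(2) by linarith
  then obtain t where t: "\<forall>l\<in>{1..k}. t l \<le> h l" "(\<Sum>l\<in>{1..k}. t l) = T"
    using sum_prescribed_total[of "{1..k}" T h] by auto
  \<comment> \<open>Of the \<open>h l\<close> pairs, \<open>t l\<close> are put on the diagonal and
    the other \<open>g l\<close> are placed in mirror-image cells off it.\<close>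
  define f where "f l = d l + p l + 2 * t l" for l
  define g where "g l = h l - t l" for l
  have fg: "2 * g l + f l = d l + p l + 2 * h l" if "l \<in> {1..k}" for l
    using bspec[OF t(1) that] by (simp add: f_def g_def)
  have sumf: "(\<Sum>l\<in>{1..k}. f l) = m"
    unfolding f_def sum.distrib[of "\<lambda>l. d l + p l"] sumdo sum_distrib_left[symmetric] t m(2) ..
  have "(\<Sum>l\<in>{1..k}. 2 * g l) + (\<Sum>l\<in>{1..k}. f l) = (\<Sum>l\<in>{1..k}. (d l + p l) + 2 * h l)"
    unfolding sum.distrib[symmetric] by (intro sum.cong) (auto simp: fg)
  also have "\<dots> = m * m"
    unfolding sum.distrib[of "\<lambda>l. d l + p l"] sumdo sum_distrib_left[symmetric] sumh ..
  finally have sumg: "(\<Sum>l\<in>{1..k}. 2 * g l) = m * (m - 1)"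
    unfolding sumf by (simp add: diff_mult_distrib2)
  have deg: "b l + 2 * g l + f l \<le> m" if l: "l \<in> {1..k}" for l
  proof -
    \<comment> \<open>The lower bound on \<open>b l\<close>. The places left for \<open>l\<close>
      number \<open>\<rho> l - e l - b l\<close>, which is therefore at most
      \<open>m\<close>.\<close>
    have "int (\<rho> l) \<le> int (e l) + int (b l) + int m"
      using bspec[OF B(2) l] m(1) by (simp add: b_def)
    then show ?thesis using fg[OF l] h[OF l] by linarith
  qed
  have "outline k r m L B f g"
    unfolding outline_def using lat assms(10) B sumf sumg deg by (auto simp: b_def)
  from outline_completion[OF this] obtain L' where
    L': "latin_array n k L'" "symmetric_array n L'" "top_left_subarray r L L'"
    "\<forall>l\<in>{1..k}. occurrences n L' l = occurrences r L l + 2 * b l + 2 * g l + f l"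
    "\<forall>l\<in>{1..k}. card {i \<in> {r + 1..n}. L' i i = l} = f l"
    unfolding m(1)[symmetric] b_def by blast
  have "occurrences n L' l = \<rho> l" if "l \<in> {1..k}" for l
    using L'(4) that assms(11) fg[OF that] h[OF that] by auto
  moreover have "prescribed_diagonal_tail r n k d L'"
    using L'(5) by (auto simp: prescribed_diagonal_tail_def f_def)
  ultimately show "\<exists>L'. rho_latin_square n k \<rho> L' \<and> symmetric_array n L' \<and>
               top_left_subarray r L L' \<and> prescribed_diagonal_tail r n k d L'"
    using L' by (intro exI[of _ L']) (auto simp: rho_latin_square_def)
qed

end
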